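(* Let $G$ be the complete $r$-partite graph with parts $V_1,\dots,V_r$ and total order $n$. Then $G$ admits an $\varepsilon$-factorization with an error matrix $E$ satisfying \[ \|E\|_0\le \sum_{\substack{b\in[r]\\ |V_b|\text{ odd}}}(n-|V_b|). \] In particular, $G$ admits an $\varepsilon$-factorization with $\varepsilon\le r/n$. If every part has even size, then $G$ admits a $0$-factorization.
   Context: All graphs are finite, simple and undirected; $A(H)$ is the adjacency matrix of $H$. Let $0\le \varepsilon\le 1$. Fix an ordering $v_1,\dots,v_n$ of $V(G)$. An $\varepsilon$-factorization of $G$ (equivalently, of $A(G)$) with error matrix $E$ is a triple $(H,K,E)$ where $H$ and $K$ are simple graphs on $V(G)$, $E\in\{0,1\}^{n\times n}$ satisfies $\|E\|_0\le\varepsilon n^2$, and $(A(H)A(K))_{ij}=A(G)_{ij}$ for every $(i,j)$ with $E_{ij}=0$. Here $\|E\|_0$ is the number of nonzero entries of $E$, and $[r]=\{1,\dots,r\}$. *)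

theory Defs
  imports
    Complex_Main
    "HOL-Library.Disjoint_Sets"
    "Graph_Theory.Pair_Digraph"
    "Jordan_Normal_Form.Matrix"
begin

text \<open>
  Finite simple undirected graphs are rendered by the locale \<^locale>\<open>pair_graph\<close>: finite vertex
  set, no loops, and an undirected edge is represented by its two opposite arcs.

  Matrices of graphs are taken with respect to an ordering of the vertices, given as a list.
  Row and column indices start at 0, so \<^term>\<open>vs ! i\<close> is the usual $v_{i+1}$.
\<close>

definition vertex_ordering :: "'a pair_pre_digraph \<Rightarrow> 'a list \<Rightarrow> bool" where
  "vertex_ordering G vs \<longleftrightarrow> distinct vs \<and> set vs = pverts G"

definition adj_mat :: "'a list \<Rightarrow> 'a pair_pre_digraph \<Rightarrow> int mat" where
  "adj_mat vs G =
     mat (length vs) (length vs) (\<lambda>(i, j). if (vs ! i, vs ! j) \<in> parcs G then 1 else 0)"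

definition norm0 :: "'a :: zero mat \<Rightarrow> nat" where
  "norm0 E = card {(i, j). i < dim_row E \<and> j < dim_col E \<and> E $$ (i, j) \<noteq> 0}"

definition eps_factorization ::
  "real \<Rightarrow> 'a list \<Rightarrow> 'a pair_pre_digraph
     \<Rightarrow> 'a pair_pre_digraph \<Rightarrow> 'a pair_pre_digraph \<Rightarrow> int mat \<Rightarrow> bool" where
  "eps_factorization \<epsilon> vs G H K E \<longleftrightarrow>
     (let n = card (pverts G) in
       0 \<le> \<epsilon> \<and> \<epsilon> \<le> 1 \<and>
       pair_graph H \<and> pverts H = pverts G \<and>
       pair_graph K \<and> pverts K = pverts G \<and>
       E \<in> carrier_mat n n \<and> elements_mat E \<subseteq> {0, 1} \<and>
       real (norm0 E) \<le> \<epsilon> * real n ^ 2 \<and>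
       (\<forall>i<n. \<forall>j<n. E $$ (i, j) = 0 \<longrightarrow>
          (adj_mat vs H * adj_mat vs K) $$ (i, j) = adj_mat vs G $$ (i, j)))"

text \<open>Empty parts are allowed, as in \<open>complete_bipartite_digraph\<close> of the graph library.\<close>

definition complete_multipartite ::
  "'a pair_pre_digraph \<Rightarrow> nat \<Rightarrow> (nat \<Rightarrow> 'a set) \<Rightarrow> bool" where
  "complete_multipartite G r V \<longleftrightarrow>
     pair_graph G \<and>
     disjoint_family_on V {1..r} \<and>
     pverts G = (\<Union>b\<in>{1..r}. V b) \<and>
     parcs G = {(u, v). \<exists>a\<in>{1..r}. \<exists>b\<in>{1..r}. a \<noteq> b \<and> u \<in> V a \<and> v \<in> V b}"

end

theory Submission
  imports Defs
begin

text \<open>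
  Two vertices in the same part of a complete multipartite graph \<open>G\<close> are twins: they have the
  same neighbours. If \<open>p\<close> is an involution of the vertices that sends every vertex to a twin, let
  \<open>K\<close> be the matching that joins \<open>v\<close> to \<open>p v\<close> whenever these differ. Multiplying \<open>A(G)\<close> by \<open>A(K)\<close>
  on the right replaces the column of \<open>v\<close> by the column of \<open>p v\<close>, which is the same column, unless
  \<open>p\<close> fixes \<open>v\<close>; then \<open>v\<close> is isolated in \<open>K\<close> and its column becomes zero. So \<open>A(G) A(K)\<close> differs
  from \<open>A(G)\<close> exactly at the arcs of \<open>G\<close> that end in a fixed point of \<open>p\<close>
  (\<open>twin_involution_factorization\<close>).

  Pairing off the vertices inside each part leaves no fixed point in an even part and a single one
  in an odd part \<open>V b\<close> (\<open>near_perfect_involution\<close>, \<open>partwise_involution\<close>). That fixed point has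
  \<open>n - |V b|\<close> neighbours, and adding these over the odd parts bounds the number of errors by
  \<open>r n\<close>, hence by \<open>(r / n) n\<^sup>2\<close>.
\<close>

section \<open>Pairing off the points of finite sets\<close>

text \<open>
  Adding a point \<open>a\<close> to \<open>S\<close> pairs \<open>a\<close> with the leftover point of \<open>S\<close> if there is one, and
  otherwise makes \<open>a\<close> the leftover point.
\<close>

lemma near_perfect_involution:
  assumes "finite S"
  shows "\<exists>p. (\<forall>x\<in>S. p x \<in> S \<and> p (p x) = x) \<and> card {x \<in> S. p x = x} = card S mod 2"
  using assms
proof (induction S rule: finite_induct)
  case empty
  then show ?case by simp
next
  case (insert a S)
  then obtain p where p: "\<And>x. x \<in> S \<Longrightarrow> p x \<in> S" "\<And>x. x \<in> S \<Longrightarrow> p (p x) = x"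
    and fixed: "card {x \<in> S. p x = x} = card S mod 2"
    by blast
  show ?case
  proof (cases "even (card S)")
    case True
    then have "{x \<in> S. p x = x} = {}"
      using fixed insert.hyps by simp
    then have "{x \<in> insert a S. (p(a := a)) x = x} = {a}"
      using insert.hyps by auto
    moreover have "\<forall>x\<in>insert a S. (p(a := a)) x \<in> insert a S \<and> (p(a := a)) ((p(a := a)) x) = x"
      using p insert.hyps by auto
    moreover have "card (insert a S) mod 2 = 1"
      using True insert.hyps by (simp add: mod_Suc even_iff_mod_2_eq_zero)
    ultimately show ?thesis
      by (intro exI[of _ "p(a := a)"]) simp
  next
    case False
    then have "card {x \<in> S. p x = x} = 1"
      using fixed by presburger
    then obtain c where c: "{x \<in> S. p x = x} = {c}"
      by (auto simp: card_1_singleton_iff)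
    let ?q = "p(a := c, c := a)"
    have cS: "c \<in> S" "p c = c" and ac: "a \<noteq> c"
      using c insert.hyps by auto
    have other: "p x \<noteq> c" "p x \<noteq> x" if "x \<in> S" "x \<noteq> c" for x
      using that c p cS by (metis, blast)
    have "{x \<in> insert a S. ?q x = x} = {}"
      using other ac by auto
    moreover have "\<forall>x\<in>insert a S. ?q x \<in> insert a S \<and> ?q (?q x) = x"
    proof
      fix x assume "x \<in> insert a S"
      then consider "x = a" | "x = c" | "x \<in> S" "x \<noteq> c" "x \<noteq> a"
        by blast
      then show "?q x \<in> insert a S \<and> ?q (?q x) = x"
      proof cases
        case 3
        then have "p x \<in> S" "p x \<noteq> c" "p x \<noteq> a"
          using p other insert.hyps by auto
        then show ?thesis using 3 p by simp
      qed (use cS ac in auto)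
    qed
    moreover have "card (insert a S) mod 2 = 0"
      using False insert.hyps by (simp add: mod_Suc odd_iff_mod_2_eq_one)
    ultimately show ?thesis
      by (intro exI[of _ ?q]) (simp only: card.empty)
  qed
qed

lemma partwise_involution:
  assumes "disjoint_family_on V I" and "\<And>b. b \<in> I \<Longrightarrow> finite (V b)"
  shows "\<exists>p. \<forall>b\<in>I. (\<forall>x\<in>V b. p x \<in> V b \<and> p (p x) = x) \<and>
                card {x \<in> V b. p x = x} = card (V b) mod 2"
proof -
  have "\<forall>b\<in>I. \<exists>p. (\<forall>x\<in>V b. p x \<in> V b \<and> p (p x) = x) \<and>
                card {x \<in> V b. p x = x} = card (V b) mod 2"
    using near_perfect_involution assms(2) by blast
  then obtain f where f: "\<forall>b\<in>I. (\<forall>x\<in>V b. f b x \<in> V b \<and> f b (f b x) = x) \<and>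
                card {x \<in> V b. f b x = x} = card (V b) mod 2"
    by (rule bchoice[THEN exE])
  define part where "part x = (THE b. b \<in> I \<and> x \<in> V b)" for x
  have part: "part x = b" if "b \<in> I" "x \<in> V b" for x b
    unfolding part_def using that assms(1)
    by (intro the_equality) (auto simp: disjoint_family_on_def)
  have "(\<forall>x\<in>V b. f (part x) x \<in> V b \<and> f (part (f (part x) x)) (f (part x) x) = x) \<and>
      card {x \<in> V b. f (part x) x = x} = card (V b) mod 2" if b: "b \<in> I" for b
  proof -
    have "{x \<in> V b. f (part x) x = x} = {x \<in> V b. f b x = x}"
      using part b by auto
    then show ?thesis
      using f part b by simp
  qed
  then show ?thesis
    by (intro exI[of _ "\<lambda>x. f (part x) x"]) simp
qed

section \<open>Factorizations from involutions that preserve neighbourhoods\<close>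

lemma norm0_le_square:
  assumes "E \<in> carrier_mat n n"
  shows "norm0 E \<le> n\<^sup>2"
proof -
  have "norm0 E \<le> card ({..<n} \<times> {..<n})"
    unfolding norm0_def using assms by (intro card_mono) auto
  then show ?thesis
    by (simp add: power2_eq_square)
qed

text \<open>
  The factors are \<open>G\<close> itself and the matching of each \<open>v\<close> with \<open>p v \<noteq> v\<close>, as explained above.
  The smallest possible tolerance \<open>norm0 E / n\<^sup>2\<close> is recorded, so that every later bound on
  \<open>\<epsilon>\<close> is a bound on the number of errors.
\<close>

lemma twin_involution_factorization:
  assumes G: "pair_graph G" and vs: "vertex_ordering G vs"
    and p: "\<And>v. v \<in> pverts G \<Longrightarrow> p v \<in> pverts G" "\<And>v. v \<in> pverts G \<Longrightarrow> p (p v) = v"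
    and twins: "\<And>u v. u \<in> pverts G \<Longrightarrow> v \<in> pverts G \<Longrightarrow> (u, p v) \<in> parcs G \<longleftrightarrow> (u, v) \<in> parcs G"
  shows "\<exists>H K E. eps_factorization (real (norm0 E) / (real (card (pverts G)))\<^sup>2) vs G H K E \<and>
                 norm0 E = card {(u, v) \<in> parcs G. p v = v}"
proof -
  interpret G: pair_graph G by (rule G)
  define n where "n = card (pverts G)"
  have dist: "distinct vs" and set_vs: "set vs = pverts G"
    using vs by (auto simp: vertex_ordering_def)
  have len: "length vs = n"
    using dist set_vs by (metis n_def distinct_card)
  have nth: "vs ! i \<in> pverts G" if "i < n" for i
    using that set_vs len by (metis nth_mem)
  define K where "K = \<lparr>pverts = pverts G, parcs = {(u, v). v \<in> pverts G \<and> u = p v \<and> u \<noteq> v}\<rparr>"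
  define E :: "int mat" where
    "E = mat n n (\<lambda>(i, j). if (vs ! i, vs ! j) \<in> parcs G \<and> p (vs ! j) = vs ! j then 1 else 0)"
  have K: "pair_graph K"
  proof -
    have arcs: "parcs K \<subseteq> pverts G \<times> pverts G"
      using p(1) by (auto simp: K_def)
    have "sym (parcs K)"
      using p by (auto simp: K_def sym_def)
    moreover have "finite (parcs K)"
      using arcs by (rule finite_subset) simp
    ultimately show ?thesis
      using arcs G.pair_finite_verts
      by unfold_locales (auto simp: K_def symmetric_def arcs_ends_conv)
  qed
  have E: "E \<in> carrier_mat n n" "elements_mat E \<subseteq> {0, 1}"
    by (auto simp: E_def elements_mat_def)
  have prod: "(adj_mat vs G * adj_mat vs K) $$ (i, j) = adj_mat vs G $$ (i, j)"
    if i: "i < n" and j: "j < n" and Eij: "E $$ (i, j) = 0" for i j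
  proof -
    have "(adj_mat vs G * adj_mat vs K) $$ (i, j)
        = (\<Sum>k<n. (if (vs ! i, vs ! k) \<in> parcs G then 1 else 0) *
                   (if (vs ! k, vs ! j) \<in> parcs K then 1 else 0))"
      using i j len by (simp add: adj_mat_def scalar_prod_def atLeast0LessThan)
    also have "\<dots> = (if (vs ! i, vs ! j) \<in> parcs G then 1 else 0)"
    proof (cases "p (vs ! j) = vs ! j")
      case True
      have "(vs ! k, vs ! j) \<notin> parcs K" if "k < n" for k
        using True by (simp add: K_def)
      moreover have "(vs ! i, vs ! j) \<notin> parcs G"
        using True Eij i j by (simp add: E_def split: if_splits)
      ultimately show ?thesis by simp
    next
      case False
      obtain m where m: "m < n" "vs ! m = p (vs ! j)"
        using p(1)[OF nth[OF j]] set_vs len by (metis in_set_conv_nth)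
      \<comment> \<open>The only neighbour of \<open>vs ! j\<close> in \<open>K\<close> is its partner \<open>vs ! m\<close>.\<close>
      have "(vs ! k, vs ! j) \<in> parcs K \<longleftrightarrow> k = m" if "k < n" for k
      proof -
        have "(vs ! k, vs ! j) \<in> parcs K \<longleftrightarrow> vs ! k = vs ! m"
          using False nth[OF j] m(2) by (auto simp: K_def)
        then show ?thesis
          using dist len m(1) that by (simp add: nth_eq_iff_index_eq)
      qed
      then have "(\<Sum>k<n. (if (vs ! i, vs ! k) \<in> parcs G then 1 else 0) *
                   (if (vs ! k, vs ! j) \<in> parcs K then 1 else 0 :: int))
          = (\<Sum>k<n. if k = m then (if (vs ! i, vs ! m) \<in> parcs G then 1 else 0) else 0)"
        by (intro sum.cong) auto
      also have "\<dots> = (if (vs ! i, vs ! m) \<in> parcs G then 1 else 0)"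
        using m(1) by simp
      also have "\<dots> = (if (vs ! i, vs ! j) \<in> parcs G then 1 else 0)"
        using twins[OF nth[OF i] nth[OF j]] m(2) by simp
      finally show ?thesis .
    qed
    also have "\<dots> = adj_mat vs G $$ (i, j)"
      using i j len by (simp add: adj_mat_def)
    finally show ?thesis .
  qed
  have norm: "norm0 E = card {(u, v) \<in> parcs G. p v = v}"
  proof -
    have "bij_betw (\<lambda>(i, j). (vs ! i, vs ! j))
        {(i, j). i < dim_row E \<and> j < dim_col E \<and> E $$ (i, j) \<noteq> 0} {(u, v) \<in> parcs G. p v = v}"
    proof (rule bij_betw_imageI)
      show "inj_on (\<lambda>(i, j). (vs ! i, vs ! j))
          {(i, j). i < dim_row E \<and> j < dim_col E \<and> E $$ (i, j) \<noteq> 0}"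
        using dist len by (auto simp: inj_on_def E_def nth_eq_iff_index_eq)
      show "(\<lambda>(i, j). (vs ! i, vs ! j)) ` {(i, j). i < dim_row E \<and> j < dim_col E \<and> E $$ (i, j) \<noteq> 0}
          = {(u, v) \<in> parcs G. p v = v}" (is "?f ` ?A = ?B")
      proof
        show "?f ` ?A \<subseteq> ?B"
          by (auto simp: E_def split: if_splits)
        show "?B \<subseteq> ?f ` ?A"
        proof clarify
          fix u v assume uv: "(u, v) \<in> parcs G" "p v = v"
          then have "u \<in> set vs" "v \<in> set vs"
            using G.in_arcsD1 G.in_arcsD2 set_vs by auto
          then obtain i j where "i < n" "j < n" "vs ! i = u" "vs ! j = v"
            using len by (metis in_set_conv_nth)
          then show "(u, v) \<in> ?f ` ?A"
            using uv by (intro image_eqI[of _ _ "(i, j)"]) (auto simp: E_def)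
        qed
      qed
    qed
    then show ?thesis
      unfolding norm0_def by (rule bij_betw_same_card)
  qed
  have "real (norm0 E) \<le> (real n)\<^sup>2"
    using norm0_le_square[OF E(1)] by (metis of_nat_le_iff of_nat_power)
  then have "eps_factorization (real (norm0 E) / (real n)\<^sup>2) vs G G K E"
    unfolding eps_factorization_def Let_def n_def[symmetric]
    using G K E prod by (auto simp: K_def divide_le_eq)
  then show ?thesis
    using norm unfolding n_def by blast
qed

section \<open>Complete multipartite graphs\<close>

lemma complete_multipartite_twins:
  assumes "complete_multipartite G r V" "b \<in> {1..r}" "v \<in> V b" "v' \<in> V b"
  shows "(u, v') \<in> parcs G \<longleftrightarrow> (u, v) \<in> parcs G"
proof -
  have "(u, w) \<in> parcs G \<longleftrightarrow> (\<exists>a\<in>{1..r}. a \<noteq> b \<and> u \<in> V a)" if "w \<in> V b" for w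
  proof -
    have "c = b" if "c \<in> {1..r}" "w \<in> V c" for c
      using assms(1,2) \<open>w \<in> V b\<close> that
      unfolding complete_multipartite_def disjoint_family_on_def by blast
    moreover have "(u, w) \<in> parcs G \<longleftrightarrow>
        (\<exists>a\<in>{1..r}. \<exists>c\<in>{1..r}. a \<noteq> c \<and> u \<in> V a \<and> w \<in> V c)"
      using assms(1) by (simp add: complete_multipartite_def)
    ultimately show ?thesis
      using assms(2) that by blast
  qed
  then show ?thesis
    using assms(3,4) by blast
qed

text \<open>
  Every error is an arc that ends in the unpaired vertex of some odd part and starts outside that
  part, so there are at most \<open>n - |V b|\<close> of them for each odd part.
\<close>

lemma multipartite_factorization:
  assumes G: "complete_multipartite G r V" and n: "n = card (pverts G)"
    and vs: "vertex_ordering G vs"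
  shows "\<exists>H K E. eps_factorization (real (norm0 E) / (real n)\<^sup>2) vs G H K E \<and>
            norm0 E \<le> (\<Sum>b | b \<in> {1..r} \<and> odd (card (V b)). n - card (V b))"
proof -
  interpret pair_graph G
    using G by (simp add: complete_multipartite_def)
  have disj: "disjoint_family_on V {1..r}" and verts: "pverts G = (\<Union>b\<in>{1..r}. V b)"
    and arcs: "parcs G = {(u, v). \<exists>a\<in>{1..r}. \<exists>b\<in>{1..r}. a \<noteq> b \<and> u \<in> V a \<and> v \<in> V b}"
    using G unfolding complete_multipartite_def by (metis, metis, metis)
  have part: "V b \<subseteq> pverts G" if "b \<in> {1..r}" for b
    unfolding verts using that by (rule UN_upper)
  have fin: "finite (V b)" if "b \<in> {1..r}" for b
    using part[OF that] pair_finite_verts by (rule finite_subset)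
  obtain p where p: "\<And>b x. b \<in> {1..r} \<Longrightarrow> x \<in> V b \<Longrightarrow> p x \<in> V b \<and> p (p x) = x"
    and fixed: "\<And>b. b \<in> {1..r} \<Longrightarrow> card {x \<in> V b. p x = x} = card (V b) mod 2"
    using partwise_involution[OF disj fin] by blast
  obtain H K E where
    fact: "eps_factorization (real (norm0 E) / (real n)\<^sup>2) vs G H K E" and
    norm: "norm0 E = card {(u, v) \<in> parcs G. p v = v}"
  proof -
    have "p v \<in> pverts G" "p (p v) = v" if "v \<in> pverts G" for v
      using that p verts by blast+
    moreover have "(u, p v) \<in> parcs G \<longleftrightarrow> (u, v) \<in> parcs G" if "v \<in> pverts G" for u v
      using that verts p complete_multipartite_twins[OF G] by blast
    ultimately show thesis
      using twin_involution_factorization[OF pair_graph_axioms vs, of p] that unfolding n by blast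
  qed
  define B where "B = {b \<in> {1..r}. odd (card (V b))}"
  define W where "W b = (pverts G - V b) \<times> {x \<in> V b. p x = x}" for b
  have "{(u, v) \<in> parcs G. p v = v} \<subseteq> (\<Union>b\<in>B. W b)"
  proof clarify
    fix u v assume uv: "(u, v) \<in> parcs G" "p v = v"
    then obtain a b where ab: "a \<in> {1..r}" "b \<in> {1..r}" "a \<noteq> b" "u \<in> V a" "v \<in> V b"
      using arcs by auto
    then have "u \<in> pverts G - V b"
      using disj part unfolding disjoint_family_on_def by blast
    moreover have "odd (card (V b))"
    proof -
      have "{x \<in> V b. p x = x} \<noteq> {}" "finite {x \<in> V b. p x = x}"
        using uv ab fin by auto
      then have "card (V b) mod 2 \<noteq> 0"
        using fixed[OF ab(2)] by (metis card_eq_0_iff)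
      then show ?thesis by presburger
    qed
    ultimately show "(u, v) \<in> (\<Union>b\<in>B. W b)"
      using uv ab by (auto simp: B_def W_def)
  qed
  moreover have "finite (\<Union>b\<in>B. W b)"
    using fin by (auto simp: B_def W_def)
  ultimately have "norm0 E \<le> card (\<Union>b\<in>B. W b)"
    unfolding norm by (rule card_mono[rotated])
  also have "\<dots> \<le> (\<Sum>b\<in>B. card (W b))"
    by (rule card_UN_le) (simp add: B_def)
  also have "\<dots> = (\<Sum>b\<in>B. n - card (V b))"
  proof (rule sum.cong)
    fix b assume "b \<in> B"
    then have b: "b \<in> {1..r}" "odd (card (V b))"
      by (auto simp: B_def)
    then have "card {x \<in> V b. p x = x} = 1"
      using fixed by (simp add: odd_iff_mod_2_eq_one)
    then show "card (W b) = n - card (V b)"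
      using part[OF b(1)] fin[OF b(1)] by (simp add: W_def card_cartesian_product card_Diff_subset n)
  qed simp
  finally show ?thesis
    using fact unfolding B_def by blast
qed

theorem corollary1:
  fixes G :: "'a pair_pre_digraph" and V :: "nat \<Rightarrow> 'a set" and r n :: nat and vs :: "'a list"
  assumes "complete_multipartite G r V"
    and "n = card (pverts G)"
    and "vertex_ordering G vs"
  shows "(\<exists>\<epsilon> H K E. eps_factorization \<epsilon> vs G H K E \<and>
            norm0 E \<le> (\<Sum>b | b \<in> {1..r} \<and> odd (card (V b)). n - card (V b))) \<and>
         (\<exists>\<epsilon> H K E. eps_factorization \<epsilon> vs G H K E \<and> \<epsilon> \<le> real r / real n) \<and>
         ((\<forall>b\<in>{1..r}. even (card (V b))) \<longrightarrow> (\<exists>H K E. eps_factorization 0 vs G H K E))"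
proof -
  let ?B = "{b. b \<in> {1..r} \<and> odd (card (V b))}"
  obtain H K E where fact: "eps_factorization (real (norm0 E) / (real n)\<^sup>2) vs G H K E"
    and bound: "norm0 E \<le> (\<Sum>b\<in>?B. n - card (V b))"
    using multipartite_factorization[OF assms] by blast
  have "real (norm0 E) / (real n)\<^sup>2 \<le> real r / real n"
  proof -
    have "(\<Sum>b\<in>?B. n - card (V b)) \<le> (\<Sum>b\<in>{1..r}. n)"
      by (rule order_trans[OF sum_mono sum_mono2]) auto
    then have "norm0 E \<le> r * n"
      using bound by simp
    then have "real (norm0 E) \<le> real r * real n"
      by (metis of_nat_le_iff of_nat_mult)
    then have "real (norm0 E) / (real n)\<^sup>2 \<le> real r * real n / (real n)\<^sup>2"
      by (rule divide_right_mono) simp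
    \<comment> \<open>For \<open>n = 0\<close> both sides are \<open>0\<close> because \<open>x / 0 = 0\<close>.\<close>
    also have "\<dots> = real r / real n"
      by (simp add: power2_eq_square)
    finally show ?thesis .
  qed
  moreover have "eps_factorization 0 vs G H K E" if "\<forall>b\<in>{1..r}. even (card (V b))"
  proof -
    have "?B = {}"
      using that by blast
    then have "norm0 E = 0"
      using bound by (metis le_zero_eq sum.empty)
    then show ?thesis
      using fact by simp
  qed
  ultimately show ?thesis
    using fact bound by blast
qed

end
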